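(* Let $n\ge1$. Every horizontal geodesic $\gamma$ in $H_n$ is of order $1$, with constant p-curvature and zero contact normality. Therefore $\gamma$ is non-degenerate in $H_1$ (i.e. when $n=1$) and degenerate in $H_n$ for $n\ge2$.
   Context: Heisenberg group. $H_n$ is $\mathbb{R}^{2n+1}$ with coordinates $(x_1,\dots,x_n,y_1,\dots,y_n,z)$ and group law $(x,y,z)\circ(\tilde x,\tilde y,\tilde z)=(x+\tilde x,\,y+\tilde y,\,z+\tilde z+\sum_{j=1}^n(y_j\tilde x_j-x_j\tilde y_j))$. Left invariant vector fields: $\mathring e_j=\partial_{x_j}+y_j\partial_z$, $\mathring e_{n+j}=\partial_{y_j}-x_j\partial_z$ $(1\le j\le n)$, $T=\partial_z$. The contact bundle $\xi$ is spanned by $\mathring e_1,\dots,\mathring e_{2n}$; $J$ on $\xi$ is given by $J\mathring e_j=\mathring e_{n+j}$, $J\mathring e_{n+j}=-\mathring e_j$. Let $\langle\cdot,\cdot\rangle$ be the Riemannian metric for which $\mathring e_1,\dots,\mathring e_{2n},T$ are orthonormal (on $\xi$ it is the Levi metric). One identifies $H_n\cong\mathbb{C}^n\times\mathbb{R}$ via $z_j=x_j+\sqrt{-1}\,y_j$. Curves. A smooth curve $\gamma$ is written $\gamma=(\beta,z)$ with $\beta=(z_1,\dots,z_n)\in\mathbb{C}^n$. For each $k$, the coordinate derivative $\gamma^{(k)}$ decomposes as $\gamma^{(k)}_\xi+\gamma^{(k)}_T$ with $\gamma^{(k)}_\xi\in\xi$ and $\gamma^{(k)}_T$ a multiple of $T$;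 thus $\gamma^{(k)}_\xi=\sum_j(x_j^{(k)}\mathring e_j+y_j^{(k)}\mathring e_{n+j})$. The curve is horizontal if $\gamma'=\gamma'_\xi$, horizontally regular if $\gamma'_\xi\ne0$ everywhere, and parametrized by horizontal arc-length $s$ if $|\gamma'_\xi(s)|=1$ for all $s$. Horizontal geodesics. A horizontal geodesic is a horizontal curve $\gamma(s)$ parametrized by horizontal arc-length satisfying $D_{\gamma'}\gamma'+2\lambda J(\gamma')=0$ for some constant $\lambda\in\mathbb{R}$, where $D$ is the Levi-Civita connection of $\langle\cdot,\cdot\rangle$; for horizontal $\gamma$ one has $D_{\gamma'}\gamma'=\sum_j(x_j''\mathring e_j+y_j''\mathring e_{n+j})$. Order and degeneracy. A horizontally regular curve $\gamma=(\beta,z)$ in $H_n$ is of order $k$, for an integer $k\in[1,n]$, if for all $t$: $\beta'\wedge\cdots\wedge\beta^{(k+1)}=0$ and $\beta'\wedge\cdots\wedge\beta^{(k)}\neq0$, the wedge product being over $\mathbb{C}$ in $\mathbb{C}^n$. It is degenerate in $H_n$ if $\mathrm{order}(\gamma)<n$. It is non-degenerate in $H_n$ if, for all $t$, $\gamma'_\xi\wedge\cdots\wedge\gamma^{(n)}_\xi\ne0$ (real wedge product) and the real span $P$ of $\gamma'_\xi,\dots,\gamma^{(n)}_\xi$ is totally real (that is, $JX\notin P$ for every nonzero $X\in P$). Invariants. The contact normality is $\tau(s)=\langle\gamma'(s),T\rangle$. A curve of order $1$ has a single p-curvature, $\kappa_1(s)=\langle\frac{de_1}{ds},Je_1\rangle$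 with $e_1(s)=\gamma'_\xi(s)$, where $\frac{de_1}{ds}$ is the derivative of $e_1(s)$ as an $\mathbb{R}^{2n+1}$-valued function (its $\xi$-component is obtained by differentiating the coefficients with respect to $\mathring e_1,\dots,\mathring e_{2n}$). *)

theory Defs
  imports "HOL-Analysis.Analysis"
begin

section \<open>The Heisenberg group\<close>

text \<open>
  A point (or a coordinate tangent vector) of \<open>H\<^sub>n = \<real>\<^sup>2\<^sup>n\<^sup>+\<^sup>1\<close> is a triple \<open>(x, y, z)\<close>;
  the dimension \<open>n \<ge> 1\<close> is \<open>CARD('n)\<close>.  Tangent spaces are all identified with the coordinate space,
  so a tangent vector is given by its coordinates together with a base point.
\<close>

type_synonym 'n heis = "(real ^ 'n) \<times> (real ^ 'n) \<times> real"

abbreviation xc :: "'n::finite heis \<Rightarrow> real ^ 'n" where "xc p \<equiv> fst p"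
abbreviation yc :: "'n::finite heis \<Rightarrow> real ^ 'n" where "yc p \<equiv> fst (snd p)"
abbreviation zc :: "'n::finite heis \<Rightarrow> real" where "zc p \<equiv> snd (snd p)"

definition heis_mult :: "'n::finite heis \<Rightarrow> 'n heis \<Rightarrow> 'n heis" where
  "heis_mult p q =
     (xc p + xc q, yc p + yc q, zc p + zc q + (\<Sum>j\<in>UNIV. yc p $ j * xc q $ j - xc p $ j * yc q $ j))"

definition frame_X :: "'n::finite \<Rightarrow> 'n heis \<Rightarrow> 'n heis" where
  "frame_X j p = (axis j 1, 0, yc p $ j)"

definition frame_Y :: "'n::finite \<Rightarrow> 'n heis \<Rightarrow> 'n heis" where
  "frame_Y j p = (0, axis j 1, - (xc p $ j))"

definition frame_T :: "'n::finite heis" where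
  "frame_T = (0, 0, 1)"

definition contact_bundle :: "'n::finite heis \<Rightarrow> 'n heis set" where
  "contact_bundle p = span (range (\<lambda>j. frame_X j p) \<union> range (\<lambda>j. frame_Y j p))"

definition xi_part :: "'n::finite heis \<Rightarrow> 'n heis \<Rightarrow> 'n heis" where
  "xi_part p u = (\<Sum>j\<in>UNIV. (xc u $ j) *\<^sub>R frame_X j p + (yc u $ j) *\<^sub>R frame_Y j p)"

definition T_coeff :: "'n::finite heis \<Rightarrow> 'n heis \<Rightarrow> real" where
  "T_coeff p u = zc (u - xi_part p u)"

text \<open>
  The coefficients of \<open>u\<close> at \<open>p\<close> in the frame are \<open>xc u $ j\<close>, \<open>yc u $ j\<close> and \<open>T_coeff p u\<close>
  (lemma \<open>frame_decomposition\<close> below); the metric declares the frame orthonormal.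
\<close>

definition heis_metric :: "'n::finite heis \<Rightarrow> 'n heis \<Rightarrow> 'n heis \<Rightarrow> real" where
  "heis_metric p u v =
     (\<Sum>j\<in>UNIV. xc u $ j * xc v $ j + yc u $ j * yc v $ j) + T_coeff p u * T_coeff p v"

definition heis_norm :: "'n::finite heis \<Rightarrow> 'n heis \<Rightarrow> real" where
  "heis_norm p u = sqrt (heis_metric p u u)"

text \<open>
  The complex structure of the contact bundle at \<open>p\<close>.  It is only meant for \<open>u \<in> contact_bundle p\<close>;
  on other vectors the formula discards the \<open>T\<close>-component.
\<close>

definition heis_J :: "'n::finite heis \<Rightarrow> 'n heis \<Rightarrow> 'n heis" where
  "heis_J p u = (\<Sum>j\<in>UNIV. (xc u $ j) *\<^sub>R frame_Y j p - (yc u $ j) *\<^sub>R frame_X j p)"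

lemma heis_decompose_coords:
  "xc (xi_part p u) = xc u" "yc (xi_part p u) = yc u"
  "zc (xi_part p u) = (\<Sum>j\<in>UNIV. yc p $ j * xc u $ j - xc p $ j * yc u $ j)"
  by (auto simp: xi_part_def frame_X_def frame_Y_def fst_sum snd_sum vec_eq_iff axis_def
      if_distrib cong: if_cong intro!: sum.cong)

lemma frame_decomposition: "u = xi_part p u + T_coeff p u *\<^sub>R frame_T"
  by (simp add: prod_eq_iff heis_decompose_coords T_coeff_def frame_T_def)

lemma xi_part_in_contact_bundle: "xi_part p u \<in> contact_bundle p"
  unfolding xi_part_def contact_bundle_def
  by (intro span_sum span_add span_scale span_base) auto

lemma sum_axis:
  "(\<Sum>j\<in>UNIV. axis i (1::real) $ j * f j) = f i" "(\<Sum>j\<in>UNIV. f j * axis i (1::real) $ j) = f i"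
  by (simp_all add: axis_def if_distribR if_distrib[where f = "\<lambda>c. _ * c"]
      if_distrib[where f = "\<lambda>c. c * _"] cong: if_cong)

lemma heis_J_coords:
  "xc (heis_J p u) = - yc u" "yc (heis_J p u) = xc u"
  "zc (heis_J p u) = - (\<Sum>j\<in>UNIV. xc p $ j * xc u $ j + yc p $ j * yc u $ j)"
  by (auto simp: heis_J_def frame_X_def frame_Y_def fst_sum snd_sum vec_eq_iff axis_def
      if_distrib sum_negf[symmetric] algebra_simps cong: if_cong intro!: sum.cong)

lemma heis_J_frame:
  "heis_J p (frame_X j p) = frame_Y j p" "heis_J p (frame_Y j p) = - frame_X j p"
  by (simp_all add: prod_eq_iff heis_J_coords frame_X_def frame_Y_def sum_axis)

lemma heis_metric_frame:
  "heis_metric p (frame_X i p) (frame_X j p) = (if i = j then 1 else 0)"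
  "heis_metric p (frame_Y i p) (frame_Y j p) = (if i = j then 1 else 0)"
  "heis_metric p (frame_X i p) (frame_Y j p) = 0"
  "heis_metric p (frame_X i p) frame_T = 0"
  "heis_metric p (frame_Y i p) frame_T = 0"
  "heis_metric p frame_T frame_T = 1"
  by (simp_all add: heis_metric_def T_coeff_def heis_decompose_coords
      frame_X_def frame_Y_def frame_T_def sum_axis sum_subtractf sum_negf)
     (simp_all add: axis_def)

lemma frame_left_invariant:
  "frechet_derivative (heis_mult p) (at q) (frame_X j q) = frame_X j (heis_mult p q)"
  "frechet_derivative (heis_mult p) (at q) (frame_Y j q) = frame_Y j (heis_mult p q)"
  "frechet_derivative (heis_mult p) (at q) frame_T = frame_T"
proof -
  define L where "L = (\<lambda>u :: 'a heis. (xc u, yc u,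
    zc u + (\<Sum>j\<in>UNIV. yc p $ j * xc u $ j - xc p $ j * yc u $ j)))"
  have "(heis_mult p has_derivative L) (at q)"
    unfolding heis_mult_def[abs_def] L_def
    by (auto intro!: derivative_eq_intros bounded_linear.has_derivative[OF bounded_linear_vec_nth])
  then have "frechet_derivative (heis_mult p) (at q) = L"
    by (rule frechet_derivative_at[symmetric])
  then show
    "frechet_derivative (heis_mult p) (at q) (frame_X j q) = frame_X j (heis_mult p q)"
    "frechet_derivative (heis_mult p) (at q) (frame_Y j q) = frame_Y j (heis_mult p q)"
    "frechet_derivative (heis_mult p) (at q) frame_T = frame_T"
    by (simp_all add: L_def frame_X_def frame_Y_def frame_T_def heis_mult_def sum_axis sum_negf)
qed


section \<open>Curves\<close>

text \<open>
  Curves are defined on a nondegenerate interval \<open>I\<close>, open or not, bounded or not; derivatives are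
  taken within \<open>I\<close>, hence one-sided at an end point belonging to \<open>I\<close>.
\<close>

definition nderiv :: "real set \<Rightarrow> nat \<Rightarrow> (real \<Rightarrow> 'v) \<Rightarrow> real \<Rightarrow> 'v::real_normed_vector" where
  "nderiv I k f = ((\<lambda>g t. vector_derivative g (at t within I)) ^^ k) f"

definition smooth_curve :: "real set \<Rightarrow> (real \<Rightarrow> 'v::real_normed_vector) \<Rightarrow> bool" where
  "smooth_curve I f \<longleftrightarrow>
     is_interval I \<and> interior I \<noteq> {} \<and> (\<forall>k. nderiv I k f differentiable_on I)"

definition xi_deriv :: "real set \<Rightarrow> nat \<Rightarrow> (real \<Rightarrow> 'n::finite heis) \<Rightarrow> real \<Rightarrow> 'n heis" where
  "xi_deriv I k \<gamma> t = xi_part (\<gamma> t) (nderiv I k \<gamma> t)"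

definition horizontal :: "real set \<Rightarrow> (real \<Rightarrow> 'n::finite heis) \<Rightarrow> bool" where
  "horizontal I \<gamma> \<longleftrightarrow> smooth_curve I \<gamma> \<and> (\<forall>t\<in>I. nderiv I 1 \<gamma> t = xi_deriv I 1 \<gamma> t)"

definition horizontally_regular :: "real set \<Rightarrow> (real \<Rightarrow> 'n::finite heis) \<Rightarrow> bool" where
  "horizontally_regular I \<gamma> \<longleftrightarrow> smooth_curve I \<gamma> \<and> (\<forall>t\<in>I. xi_deriv I 1 \<gamma> t \<noteq> 0)"

definition horizontal_arclength :: "real set \<Rightarrow> (real \<Rightarrow> 'n::finite heis) \<Rightarrow> bool" where
  "horizontal_arclength I \<gamma> \<longleftrightarrow>
     smooth_curve I \<gamma> \<and> (\<forall>s\<in>I. heis_norm (\<gamma> s) (xi_deriv I 1 \<gamma> s) = 1)"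


section \<open>Horizontal geodesics\<close>

definition metric_deriv :: "'n::finite heis \<Rightarrow> 'n heis \<Rightarrow> 'n heis \<Rightarrow> 'n heis \<Rightarrow> real" where
  "metric_deriv p u v w = frechet_derivative (\<lambda>q. heis_metric q v w) (at p) u"

text \<open>
  Christoffel symbols of the first kind in the global coordinates, contracted with three vectors:
  \<open>\<langle>D\<^sub>u v, w\<rangle>\<close> for constant-coefficient vector fields \<open>u\<close>, \<open>v\<close>, \<open>w\<close>.
\<close>

definition christoffel :: "'n::finite heis \<Rightarrow> 'n heis \<Rightarrow> 'n heis \<Rightarrow> 'n heis \<Rightarrow> real" where
  "christoffel p u v w = (metric_deriv p u v w + metric_deriv p v u w - metric_deriv p w u v) / 2"

text \<open>
  The Levi-Civita derivative \<open>D\<^bsub>\<gamma>'\<^esub> V\<close> of a vector field \<open>V\<close> along \<open>\<gamma>\<close>, whose coordinates are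
  \<open>dV\<^sup>k/dt + \<Gamma>\<^sup>k\<^sub>i\<^sub>j \<gamma>'\<^sup>i V\<^sup>j\<close>, with the upper index lowered by the metric.
  For \<open>V = \<gamma>'\<close> with \<open>\<gamma>\<close> horizontal it is \<open>\<Sum>\<^sub>j (x\<^sub>j'' e\<^sub>j + y\<^sub>j'' e\<^bsub>n+j\<^esub>)\<close>: lemma \<open>cov_deriv_horizontal\<close>.
\<close>

definition cov_deriv ::
  "real set \<Rightarrow> (real \<Rightarrow> 'n::finite heis) \<Rightarrow> (real \<Rightarrow> 'n heis) \<Rightarrow> real \<Rightarrow> 'n heis" where
  "cov_deriv I \<gamma> V t = (THE a. \<forall>w. heis_metric (\<gamma> t) a w =
     heis_metric (\<gamma> t) (nderiv I 1 V t) w + christoffel (\<gamma> t) (nderiv I 1 \<gamma> t) (V t) w)"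

lemma T_coeff_eq: "T_coeff p u = zc u - (\<Sum>j\<in>UNIV. yc p $ j * xc u $ j - xc p $ j * yc u $ j)"
  by (simp add: T_coeff_def heis_decompose_coords)

lemma T_coeff_linear: "linear (T_coeff p)"
  by (rule linearI) (simp_all add: T_coeff_eq algebra_simps sum.distrib sum_subtractf sum_distrib_left)

lemma metric_deriv_eq:
  fixes p u v w :: "'n::finite heis"
  defines "d \<equiv> \<lambda>v. - (\<Sum>j\<in>UNIV. yc u $ j * xc v $ j - xc u $ j * yc v $ j)"
  shows "metric_deriv p u v w = d v * T_coeff p w + T_coeff p v * d w"
proof -
  have "((\<lambda>q. heis_metric q v w) has_derivative (\<lambda>u.
     (- (\<Sum>j\<in>UNIV. yc u $ j * xc v $ j - xc u $ j * yc v $ j)) * T_coeff p w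
     + T_coeff p v * (- (\<Sum>j\<in>UNIV. yc u $ j * xc w $ j - xc u $ j * yc w $ j)))) (at p)"
    unfolding heis_metric_def T_coeff_eq
    by (auto intro!: derivative_eq_intros bounded_linear.has_derivative[OF bounded_linear_vec_nth])
  from frechet_derivative_at[OF this, symmetric] show ?thesis
    unfolding metric_deriv_def d_def by simp
qed

lemma heis_metric_nondegenerate: assumes "\<forall>w. heis_metric p a w = heis_metric p b w" shows "a = b"
proof -
  have 0: "heis_metric p (a-b) (a-b) = 0"
  proof -
    have "heis_metric p (a-b) w = heis_metric p a w - heis_metric p b w" for w
      by (simp add: heis_metric_def linear_diff[OF T_coeff_linear] algebra_simps sum.distrib sum_subtractf)
    then show ?thesis using spec[OF assms, of "a - b"] by (metis diff_self)
  qed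
  have A: "(\<Sum>j\<in>UNIV. xc (a-b) $ j * xc (a-b) $ j + yc (a-b) $ j * yc (a-b) $ j) \<ge> 0"
    by (intro sum_nonneg) auto
  have 1: "T_coeff p (a-b) = 0" using 0 A unfolding heis_metric_def
    by (smt (verit) mult_eq_0_iff zero_le_square)
  then have "(\<Sum>j\<in>UNIV. xc (a-b) $ j * xc (a-b) $ j + yc (a-b) $ j * yc (a-b) $ j) = 0"
    using 0 by (simp add: heis_metric_def)
  then have "\<And>j. xc (a-b) $ j * xc (a-b) $ j + yc (a-b) $ j * yc (a-b) $ j = 0"
    by (subst (asm) sum_nonneg_eq_0_iff) auto
  then have 2: "xc (a-b) $ j = 0 \<and> yc (a-b) $ j = 0" for j by (simp add: sum_squares_eq_zero_iff)
  have "a - b = 0" using 1 2 by (simp add: prod_eq_iff vec_eq_iff T_coeff_eq)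
  then show ?thesis by simp
qed

lemma cov_deriv_horizontal_coords:
  assumes h: "horizontal I \<gamma>" and t: "t \<in> I"
  shows "cov_deriv I \<gamma> (nderiv I 1 \<gamma>) t = nderiv I 2 \<gamma> t"
    "T_coeff (\<gamma> t) (nderiv I 1 \<gamma> t) = 0"
proof -
  show T0: "T_coeff (\<gamma> t) (nderiv I 1 \<gamma> t) = 0"
    using h t unfolding horizontal_def xi_deriv_def T_coeff_def by simp
  have c: "christoffel (\<gamma> t) (nderiv I 1 \<gamma> t) (nderiv I 1 \<gamma> t) w = 0" for w
    by (simp add: christoffel_def metric_deriv_eq T0[simplified])
  have n: "nderiv I 1 (nderiv I 1 \<gamma>) = nderiv I 2 \<gamma>"
    by (simp add: nderiv_def numeral_2_eq_2)
  show "cov_deriv I \<gamma> (nderiv I 1 \<gamma>) t = nderiv I 2 \<gamma> t"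
    unfolding cov_deriv_def n c by (rule the_equality) (simp, rule heis_metric_nondegenerate, simp only: add_0_right)
qed

lemma interval_at_within_nontrivial:
  fixes I :: "real set" assumes "is_interval I" "interior I \<noteq> {}" "t \<in> I" shows "at t within I \<noteq> bot"
proof -
  have "connected I" using assms by (simp add: is_interval_connected)
  moreover have "\<nexists>a. I = {a}" using assms(2) by auto
  ultimately show ?thesis using connected_imp_perfect[of I t] assms(3)
    by (simp add: trivial_limit_within)
qed

lemma cov_deriv_horizontal:
  assumes h: "horizontal I \<gamma>" and t: "t \<in> I"
  shows "cov_deriv I \<gamma> (nderiv I 1 \<gamma>) t = xi_deriv I 2 \<gamma> t"
proof -
  have sm: "smooth_curve I \<gamma>" using h by (simp add: horizontal_def)
  have nt: "at t within I \<noteq> bot" using sm t interval_at_within_nontrivial by (auto simp: smooth_curve_def)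
  have D: "(nderiv I k \<gamma> has_vector_derivative nderiv I (Suc k) \<gamma> t) (at t within I)" for k
    using sm t by (simp add: smooth_curve_def differentiable_on_def nderiv_def vector_derivative_works[symmetric])
  define a where "a = nderiv I 1 \<gamma>" 
  have g: "(\<gamma> has_vector_derivative a t) (at t within I)" using D[of 0] by (simp add: nderiv_def a_def)
  have a: "(a has_vector_derivative nderiv I 2 \<gamma> t) (at t within I)" using D[of 1] by (simp add: a_def numeral_2_eq_2)
  have lin: "((\<lambda>s. L (f s)) has_real_derivative L f') (at t within I)" if "bounded_linear L" "(f has_vector_derivative f') (at t within I)" for L :: "'a heis \<Rightarrow> real" and f f'
    using bounded_linear.has_vector_derivative[OF that] by (simp add: has_real_derivative_iff_has_vector_derivative)
  have X: "bounded_linear (\<lambda>u::'a heis. xc u $ j)" "bounded_linear (\<lambda>u::'a heis. yc u $ j)" "bounded_linear (\<lambda>u::'a heis. zc u)" for j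
    by (auto intro!: bounded_linear_intros bounded_linear_compose[OF bounded_linear_vec_nth])
  have "((\<lambda>s. T_coeff (\<gamma> s) (a s)) has_real_derivative T_coeff (\<gamma> t) (nderiv I 2 \<gamma> t)) (at t within I)"
    unfolding T_coeff_eq
    apply (rule derivative_eq_intros lin[OF X(1) g] lin[OF X(2) g] lin[OF X(1) a] lin[OF X(2) a] lin[OF X(3) a] refl)+
    apply (simp add: algebra_simps)
    done
  moreover have "((\<lambda>s. T_coeff (\<gamma> s) (a s)) has_real_derivative 0) (at t within I)"
    unfolding has_real_derivative_iff_has_vector_derivative
    by (rule has_vector_derivative_transform[OF t _ has_vector_derivative_const[of 0]])
       (simp only: a_def cov_deriv_horizontal_coords(2)[OF h])
  ultimately have "T_coeff (\<gamma> t) (nderiv I 2 \<gamma> t) = 0"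
    using nt by (metis has_real_derivative_iff_has_vector_derivative vector_derivative_unique_within)
  then show ?thesis using frame_decomposition[of "nderiv I 2 \<gamma> t" "\<gamma> t"]
    unfolding cov_deriv_horizontal_coords(1)[OF h t] by (simp add: xi_deriv_def)
qed

definition horizontal_geodesic :: "real set \<Rightarrow> (real \<Rightarrow> 'n::finite heis) \<Rightarrow> bool" where
  "horizontal_geodesic I \<gamma> \<longleftrightarrow> horizontal I \<gamma> \<and> horizontal_arclength I \<gamma> \<and>
     (\<exists>c::real. \<forall>s\<in>I. cov_deriv I \<gamma> (nderiv I 1 \<gamma>) s + (2 * c) *\<^sub>R heis_J (\<gamma> s) (nderiv I 1 \<gamma> s) = 0)"


section \<open>Order and degeneracy\<close>

text \<open>
  The wedge product \<open>v\<^sub>1 \<and> \<dots> \<and> v\<^sub>k\<close> as the antisymmetric tensor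
  \<open>\<Sum>\<^sub>\<sigma> sign \<sigma> v\<^bsub>\<sigma> 1\<^esub> \<otimes> \<dots> \<otimes> v\<^bsub>\<sigma> k\<^esub>\<close>, given by its components: the value at the multi-index \<open>m\<close>
  is obtained by applying the coordinate functionals \<open>coord (m 1), \<dots>, coord (m k)\<close> to the factors.
\<close>

definition wedge ::
  "('i \<Rightarrow> 'v \<Rightarrow> 'a::comm_ring_1) \<Rightarrow> nat \<Rightarrow> (nat \<Rightarrow> 'v) \<Rightarrow> (nat \<Rightarrow> 'i) \<Rightarrow> 'a" where
  "wedge coord k v =
     (\<lambda>m. \<Sum>\<sigma> | \<sigma> permutes {1..k}. of_int (sign \<sigma>) * (\<Prod>a=1..k. coord (m a) (v (\<sigma> a))))"

definition wedge_complex :: "nat \<Rightarrow> (nat \<Rightarrow> complex ^ 'n) \<Rightarrow> (nat \<Rightarrow> 'n) \<Rightarrow> complex" where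
  "wedge_complex = wedge (\<lambda>i w. w $ i)"

text \<open>
  For the real wedge product the index of a functional is the vector representing it under the
  Euclidean inner product; so all linear functionals are used, not only those dual to a basis.
\<close>

definition wedge_real :: "nat \<Rightarrow> (nat \<Rightarrow> 'v::euclidean_space) \<Rightarrow> (nat \<Rightarrow> 'v) \<Rightarrow> real" where
  "wedge_real = wedge (\<lambda>b w. b \<bullet> w)"

definition beta :: "(real \<Rightarrow> 'n::finite heis) \<Rightarrow> real \<Rightarrow> complex ^ 'n" where
  "beta \<gamma> t = (\<chi> j. Complex (xc (\<gamma> t) $ j) (yc (\<gamma> t) $ j))"

definition has_order :: "real set \<Rightarrow> (real \<Rightarrow> 'n::finite heis) \<Rightarrow> nat \<Rightarrow> bool" where
  "has_order I \<gamma> k \<longleftrightarrow> horizontally_regular I \<gamma> \<and> 1 \<le> k \<and> k \<le> CARD('n) \<and>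
     (\<forall>t\<in>I. wedge_complex (k + 1) (\<lambda>i. nderiv I i (beta \<gamma>) t) = (\<lambda>_. 0) \<and>
            wedge_complex k (\<lambda>i. nderiv I i (beta \<gamma>) t) \<noteq> (\<lambda>_. 0))"

definition degenerate :: "real set \<Rightarrow> (real \<Rightarrow> 'n::finite heis) \<Rightarrow> bool" where
  "degenerate I \<gamma> \<longleftrightarrow> (\<exists>k. has_order I \<gamma> k \<and> k < CARD('n))"

definition totally_real :: "'n::finite heis \<Rightarrow> 'n heis set \<Rightarrow> bool" where
  "totally_real p P \<longleftrightarrow> (\<forall>u\<in>P. u \<noteq> 0 \<longrightarrow> heis_J p u \<notin> P)"

definition nondegenerate :: "real set \<Rightarrow> (real \<Rightarrow> 'n::finite heis) \<Rightarrow> bool" where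
  "nondegenerate I \<gamma> \<longleftrightarrow> horizontally_regular I \<gamma> \<and>
     (\<forall>t\<in>I. wedge_real CARD('n) (\<lambda>i. xi_deriv I i \<gamma> t) \<noteq> (\<lambda>_. 0) \<and>
            totally_real (\<gamma> t) (span ((\<lambda>i. xi_deriv I i \<gamma> t) ` {1..CARD('n)})))"


section \<open>Invariants\<close>

definition contact_normality :: "real set \<Rightarrow> (real \<Rightarrow> 'n::finite heis) \<Rightarrow> real \<Rightarrow> real" where
  "contact_normality I \<gamma> s = heis_metric (\<gamma> s) (nderiv I 1 \<gamma> s) frame_T"

text \<open>
  The \<open>p\<close>-curvature \<open>\<kappa>\<^sub>1\<close> of a curve of order 1 parametrized by horizontal arc-length, with
  \<open>e\<^sub>1 = \<gamma>'\<^sub>\<xi>\<close>.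
\<close>

definition p_curvature :: "real set \<Rightarrow> (real \<Rightarrow> 'n::finite heis) \<Rightarrow> real \<Rightarrow> real" where
  "p_curvature I \<gamma> s =
     heis_metric (\<gamma> s) (nderiv I 1 (xi_deriv I 1 \<gamma>) s) (heis_J (\<gamma> s) (xi_deriv I 1 \<gamma> s))"

end

theory Submission
  imports Defs
begin

text \<open>
  For a horizontal curve the Levi-Civita acceleration is the coordinate second derivative, so the
  geodesic equation reads \<open>\<gamma>'' = - 2\<lambda> J \<gamma>'\<close> (lemma \<open>horizontal_geodesic_acceleration\<close>).  On the
  projection to \<open>\<complex>\<^sup>n\<close> the structure \<open>J\<close> is multiplication by \<open>\<i>\<close>, whence \<open>\<beta>'' = - 2\<lambda>\<i> \<beta>'\<close>.

  Order and curvature are read off from these two equations.  The vectors \<open>\<beta>'\<close> and \<open>\<beta>''\<close> are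
  proportional over \<open>\<complex>\<close>, so \<open>\<beta>' \<and> \<beta>'' = 0\<close>, whereas \<open>\<beta>'\<close> never vanishes because \<open>\<gamma>'\<close> is a unit
  vector of the contact bundle: the order is 1, which is less than \<open>n\<close> as soon as \<open>n \<ge> 2\<close>.
  The curvature is \<open>\<langle>\<gamma>'', J \<gamma>'\<rangle> = - 2\<lambda> |J \<gamma>'|\<^sup>2 = - 2\<lambda>\<close>, since \<open>J\<close> is an isometry of the contact
  bundle.  The contact normality is the \<open>T\<close>-coefficient of a horizontal vector.  Finally, a real
  line in the contact bundle is totally real, because \<open>J\<close> has no real eigenvalue there; for \<open>n = 1\<close> this
  is all that non-degeneracy demands beyond \<open>\<gamma>' \<noteq> 0\<close>.
\<close>

section \<open>Iterated derivatives on an interval\<close>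

lemma nderiv_1: "nderiv I 1 f t = vector_derivative f (at t within I)"
  by (simp add: nderiv_def)

lemma nderiv_has_vector_derivative:
  assumes "smooth_curve I f" "t \<in> I"
  shows "(nderiv I k f has_vector_derivative nderiv I (Suc k) f t) (at t within I)"
  using assms
  by (simp add: smooth_curve_def differentiable_on_def nderiv_def vector_derivative_works[symmetric])

text \<open>
  A point of a nondegenerate interval is never isolated, so a derivative within it is unique, and
  it only sees the values on the interval.
\<close>

lemma vector_derivative_within_interval:
  assumes "is_interval I" "interior I \<noteq> {}" "t \<in> I"
    and "(g has_vector_derivative d) (at t within I)" "\<And>s. s \<in> I \<Longrightarrow> f s = g s"
  shows "vector_derivative f (at t within I) = d"
proof (rule vector_derivative_within)
  show "at t within I \<noteq> bot"
    using assms(1-3) by (rule interval_at_within_nontrivial)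
  show "(f has_vector_derivative d) (at t within I)"
    using assms(3-5) has_vector_derivative_transform by blast
qed

lemma nderiv_bounded_linear:
  assumes L: "bounded_linear L" and sm: "smooth_curve I f" and t: "t \<in> I"
  shows "nderiv I k (\<lambda>s. L (f s)) t = L (nderiv I k f t)"
  using t
proof (induction k arbitrary: t)
  case 0
  then show ?case by (simp add: nderiv_def)
next
  case (Suc k)
  have "((\<lambda>s. L (nderiv I k f s)) has_vector_derivative L (nderiv I (Suc k) f t)) (at t within I)"
    using bounded_linear.has_vector_derivative[OF L nderiv_has_vector_derivative[OF sm Suc.prems]] .
  then have "vector_derivative (nderiv I k (\<lambda>s. L (f s))) (at t within I) = L (nderiv I (Suc k) f t)"
    using sm Suc by (intro vector_derivative_within_interval) (auto simp: smooth_curve_def)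
  then show ?case by (simp add: nderiv_def)
qed

section \<open>The complex structure of the contact bundle\<close>

text \<open>The projection of a tangent vector to \<open>\<complex>\<^sup>n\<close>, under which \<open>J\<close> becomes multiplication by \<open>\<i>\<close>.\<close>

definition complex_part :: "'n::finite heis \<Rightarrow> complex ^ 'n" where
  "complex_part u = (\<chi> j. Complex (xc u $ j) (yc u $ j))"

lemma bounded_linear_complex_part: "bounded_linear (complex_part :: 'n::finite heis \<Rightarrow> _)"
  unfolding linear_conv_bounded_linear[symmetric]
  by (rule linearI) (auto simp: complex_part_def vec_eq_iff complex_eq_iff)

lemma beta_eq: "beta \<gamma> = (\<lambda>t. complex_part (\<gamma> t))"
  by (simp add: beta_def complex_part_def fun_eq_iff)

lemma complex_part_scale: "complex_part (r *\<^sub>R u) $ j = of_real r * complex_part u $ j"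
  by (simp add: complex_part_def complex_eq_iff)

lemma complex_part_J: "complex_part (heis_J p u) $ j = \<i> * complex_part u $ j"
  by (simp add: complex_part_def heis_J_coords complex_eq_iff)

lemma complex_part_eq_0: "complex_part u = 0 \<longleftrightarrow> xc u = 0 \<and> yc u = 0"
  by (auto simp: complex_part_def vec_eq_iff complex_eq_iff)

lemma xi_part_eq_0: "xi_part p u = 0 \<longleftrightarrow> complex_part u = 0"
  by (auto simp: complex_part_eq_0 prod_eq_iff heis_decompose_coords)

lemma xi_part_linear: "linear (xi_part p)"
  by (rule linearI)
     (simp_all add: prod_eq_iff heis_decompose_coords algebra_simps sum.distrib sum_subtractf
       sum_distrib_left)

lemma T_coeff_xi_part: "T_coeff p (xi_part p u) = 0"
  by (simp add: T_coeff_eq heis_decompose_coords)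

lemma T_coeff_J: "T_coeff p (heis_J p u) = 0"
  by (simp add: T_coeff_eq heis_J_coords sum_negf[symmetric] sum_subtractf[symmetric] algebra_simps)

lemma heis_metric_J:
  assumes "T_coeff p u = 0"
  shows "heis_metric p (heis_J p u) (heis_J p u) = heis_metric p u u"
  by (simp add: heis_metric_def T_coeff_J assms heis_J_coords add.commute)

lemma heis_metric_scale_left: "heis_metric p (r *\<^sub>R u) v = r * heis_metric p u v"
  by (simp add: heis_metric_def linear_scale[OF T_coeff_linear] algebra_simps sum_distrib_left)

lemma heis_metric_frame_T: "heis_metric p u frame_T = T_coeff p u"
  by (simp add: heis_metric_def T_coeff_eq frame_T_def)

text \<open>
  On \<open>\<complex>\<^sup>n\<close>, with \<open>w\<close> the projection of \<open>u\<close>, the eigenvalue equation \<open>J u = r u\<close>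
  becomes \<open>(\<i> - r) w = 0\<close>, and \<open>\<i> \<noteq> r\<close> for real \<open>r\<close>.
  Only the projection of \<open>u\<close> is forced to vanish: \<open>J\<close> is extended to the whole tangent space by
  discarding the \<open>T\<close>-component, so \<open>T\<close> is an eigenvector for \<open>r = 0\<close>.
\<close>

lemma J_no_real_eigenvalue:
  assumes "heis_J p u = r *\<^sub>R u"
  shows "complex_part u = 0"
proof -
  have "complex_part u $ j = 0" for j
  proof -
    have "\<i> * complex_part u $ j = of_real r * complex_part u $ j"
      using complex_part_J[of p u j] complex_part_scale[of r u j] assms by metis
    then have "(\<i> - of_real r) * complex_part u $ j = 0"
      by (simp only: left_diff_distrib diff_self)
    moreover have "\<i> - of_real r \<noteq> 0"
      by (simp add: complex_eq_iff)
    ultimately show ?thesis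
      by simp
  qed
  then show ?thesis
    by (simp add: vec_eq_iff)
qed

text \<open>
  If \<open>u \<noteq> 0\<close> and \<open>J u\<close> lie on one real line, then \<open>u\<close> is an eigenvector of \<open>J\<close>; a vector of the
  contact bundle is determined by its projection to \<open>\<complex>\<^sup>n\<close>, so \<open>u\<close> would be zero.
\<close>

lemma totally_real_contact_line:
  assumes "xi_part p e = e"
  shows "totally_real p (span {e})"
  unfolding totally_real_def
proof (intro ballI impI notI)
  fix u assume u: "u \<in> span {e}" "u \<noteq> 0" and J: "heis_J p u \<in> span {e}"
  obtain a b where a: "u = a *\<^sub>R e" and b: "heis_J p u = b *\<^sub>R e"
    using u(1) J by (auto simp: span_singleton)
  have "heis_J p u = (b / a) *\<^sub>R u"
    using u(2) a b by simp
  then have "xi_part p u = 0"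
    by (simp add: J_no_real_eigenvalue xi_part_eq_0)
  moreover have "xi_part p u = u"
    by (simp add: a assms linear_scale[OF xi_part_linear])
  ultimately show False
    using u(2) by simp
qed

section \<open>Wedge products of one and two vectors\<close>

lemma wedge_1: "wedge coord 1 v m = coord (m 1) (v 1)"
  by (simp add: wedge_def)

lemma wedge_2:
  "wedge coord 2 v m = coord (m 1) (v 1) * coord (m 2) (v 2) - coord (m 1) (v 2) * coord (m 2) (v 1)"
proof -
  have *: "{1..2::nat} = {1, 2}"
    by auto
  have perms: "{\<sigma>. \<sigma> permutes {1, 2::nat}} = {id, Transposition.transpose 1 2}"
    by (auto simp: permutes_doubleton_iff simp del: One_nat_def)
  have "id (1::nat) \<noteq> Transposition.transpose 1 2 (1::nat)"
    by simp
  then have "id \<noteq> Transposition.transpose (1::nat) 2"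
    by metis
  then show ?thesis
    by (simp add: wedge_def * perms sign_swap_id del: One_nat_def)
qed

lemma wedge_complex_2_proportional:
  assumes "\<And>j. v 2 $ j = c * v 1 $ j"
  shows "wedge_complex 2 v = (\<lambda>_. 0)"
  by (simp add: wedge_complex_def wedge_2 assms fun_eq_iff)

section \<open>Horizontal geodesics\<close>

text \<open>
  Along a horizontal curve the Christoffel term of \<open>D\<^bsub>\<gamma>'\<^esub> \<gamma>'\<close> drops out, so the geodesic equation
  is one between coordinate derivatives.
\<close>

lemma horizontal_geodesic_acceleration:
  assumes "horizontal_geodesic I \<gamma>"
  obtains c where "\<And>s. s \<in> I \<Longrightarrow> nderiv I 2 \<gamma> s = (- 2 * c) *\<^sub>R heis_J (\<gamma> s) (nderiv I 1 \<gamma> s)"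
proof -
  obtain c where c: "\<forall>s\<in>I. cov_deriv I \<gamma> (nderiv I 1 \<gamma>) s
      + (2 * c) *\<^sub>R heis_J (\<gamma> s) (nderiv I 1 \<gamma> s) = 0"
    using assms by (auto simp: horizontal_geodesic_def)
  have h: "horizontal I \<gamma>"
    using assms by (simp add: horizontal_geodesic_def)
  show ?thesis
    using c by (intro that[of c])
      (simp add: cov_deriv_horizontal_coords(1)[OF h] eq_neg_iff_add_eq_0 del: One_nat_def)
qed

theorem proposition1p8:
  fixes \<gamma> :: "real \<Rightarrow> 'n::finite heis" and I :: "real set"
  assumes "horizontal_geodesic I \<gamma>"
  shows "has_order I \<gamma> 1 \<and>
    (\<exists>c. \<forall>s\<in>I. p_curvature I \<gamma> s = c) \<and>
    (\<forall>s\<in>I. contact_normality I \<gamma> s = 0) \<and>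
    (CARD('n) = 1 \<longrightarrow> nondegenerate I \<gamma>) \<and>
    (CARD('n) \<ge> 2 \<longrightarrow> degenerate I \<gamma>)"
proof -
  have h: "horizontal I \<gamma>" and "horizontal_arclength I \<gamma>"
    using assms by (auto simp: horizontal_geodesic_def)
  then have sm: "smooth_curve I \<gamma>"
    and vel: "\<And>s. s \<in> I \<Longrightarrow> xi_deriv I 1 \<gamma> s = nderiv I 1 \<gamma> s"
    and unit: "\<And>s. s \<in> I \<Longrightarrow> heis_metric (\<gamma> s) (nderiv I 1 \<gamma> s) (nderiv I 1 \<gamma> s) = 1"
    by (auto simp: horizontal_def horizontal_arclength_def heis_norm_def)
  have T0: "T_coeff (\<gamma> s) (nderiv I 1 \<gamma> s) = 0" if "s \<in> I" for s
    using T_coeff_xi_part[of "\<gamma> s"] vel[OF that] by (metis xi_deriv_def)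
  obtain c where acc: "\<And>s. s \<in> I \<Longrightarrow>
      nderiv I 2 \<gamma> s = (- 2 * c) *\<^sub>R heis_J (\<gamma> s) (nderiv I 1 \<gamma> s)"
    using horizontal_geodesic_acceleration[OF assms] by blast

  have nz: "xi_deriv I 1 \<gamma> s \<noteq> 0" if "s \<in> I" for s
    using unit[OF that] vel[OF that] heis_metric_scale_left[of "\<gamma> s" 0 0 0]
    by (auto simp del: One_nat_def)
  have regular: "horizontally_regular I \<gamma>"
    using sm nz by (simp add: horizontally_regular_def)

  have beta_deriv: "nderiv I k (beta \<gamma>) s = complex_part (nderiv I k \<gamma> s)" if "s \<in> I" for k s
    using nderiv_bounded_linear[OF bounded_linear_complex_part sm that] by (simp add: beta_eq)
  \<comment> \<open>The factor is that of \<open>\<beta>'' = - 2\<lambda>\<i> \<beta>'\<close>, with \<open>c\<close> for \<open>\<lambda>\<close>.\<close>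
  have "wedge_complex 2 (\<lambda>i. nderiv I i (beta \<gamma>) s) = (\<lambda>_. 0)" if "s \<in> I" for s
  proof (rule wedge_complex_2_proportional[where c = "of_real (- 2 * c) * \<i>"])
    fix j
    show "nderiv I 2 (beta \<gamma>) s $ j = of_real (- 2 * c) * \<i> * nderiv I 1 (beta \<gamma>) s $ j"
      by (simp only: beta_deriv[OF that] acc[OF that] complex_part_scale complex_part_J mult.assoc)
  qed
  moreover have "wedge_complex 1 (\<lambda>i. nderiv I i (beta \<gamma>) s) \<noteq> (\<lambda>_. 0)" if s: "s \<in> I" for s
  proof -
    have "complex_part (nderiv I 1 \<gamma> s) \<noteq> 0"
      using nz[OF s] by (simp add: xi_deriv_def xi_part_eq_0)
    then obtain j where "nderiv I 1 (beta \<gamma>) s $ j \<noteq> 0"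
      by (auto simp: beta_deriv[OF s] vec_eq_iff)
    then have "wedge_complex 1 (\<lambda>i. nderiv I i (beta \<gamma>) s) (\<lambda>_. j) \<noteq> 0"
      unfolding wedge_complex_def wedge_1 .
    then show ?thesis
      by (auto simp: fun_eq_iff)
  qed
  moreover have "1 \<le> CARD('n)"
    by (simp add: Suc_leI)
  ultimately have order: "has_order I \<gamma> 1"
    using regular unfolding has_order_def one_add_one by blast

  have "p_curvature I \<gamma> s = - 2 * c" if s: "s \<in> I" for s
  proof -
    \<comment> \<open>\<open>e\<^sub>1\<close> and \<open>\<gamma>'\<close> agree on \<open>I\<close>, so their derivatives within \<open>I\<close> do too.\<close>
    have "nderiv I 1 (xi_deriv I 1 \<gamma>) s = nderiv I 2 \<gamma> s"
      using sm s vel nderiv_has_vector_derivative[OF sm s, of 1]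
      unfolding nderiv_1 Suc_1
      by (intro vector_derivative_within_interval) (auto simp: smooth_curve_def nderiv_1)
    then show ?thesis
      by (simp only: p_curvature_def vel[OF s] acc[OF s] heis_metric_scale_left
          heis_metric_J[OF T0[OF s]] unit[OF s] mult_1_right)
  qed
  moreover have "contact_normality I \<gamma> s = 0" if "s \<in> I" for s
    using T0[OF that] by (simp add: contact_normality_def heis_metric_frame_T)
  moreover have "nondegenerate I \<gamma>" if n: "CARD('n) = 1"
    unfolding nondegenerate_def n
  proof (intro conjI ballI)
    fix s assume s: "s \<in> I"
    have "wedge_real 1 (\<lambda>i. xi_deriv I i \<gamma> s) (\<lambda>_. xi_deriv I 1 \<gamma> s) \<noteq> 0"
      using nz[OF s] unfolding wedge_real_def wedge_1 by simp
    then show "wedge_real 1 (\<lambda>i. xi_deriv I i \<gamma> s) \<noteq> (\<lambda>_. 0)"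
      by (auto simp: fun_eq_iff)
    have "xi_part (\<gamma> s) (xi_deriv I 1 \<gamma> s) = xi_deriv I 1 \<gamma> s"
      using vel[OF s] by (simp add: xi_deriv_def)
    then show "totally_real (\<gamma> s) (span ((\<lambda>i. xi_deriv I i \<gamma> s) ` {1..1}))"
      using totally_real_contact_line by simp
  qed (rule regular)
  moreover have "degenerate I \<gamma>" if "CARD('n) \<ge> 2"
    using order that by (auto simp: degenerate_def)
  ultimately show ?thesis
    using order by blast
qed

end
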